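(* Let $n$ be a positive integer, $0<\beta_1,\beta_2<1$, and let $\underline{V}=(V_1,V_2)$ be a random vector following the negative $\mathcal{R}(p,q)$-trinomial probability distribution of the second kind with parameters $n$, $\underline{\beta}=(\beta_1,\beta_2)$, $p$ and $q$, i.e. with mass function $$P(V_1=v_1,V_2=v_2)=\begin{bmatrix} n+v_1+v_2-1\\ v_1,v_2\end{bmatrix}_{\mathcal{R}(p,q)}\beta_1^{v_1}\beta_2^{v_2}\,(1\ominus\beta_1)^{n+v_2}_{\mathcal{R}(p,q)}\,(1\ominus\beta_2)^{n}_{\mathcal{R}(p,q)},\qquad v_1,v_2\in\mathbb{N}\cup\{0\}.$$ Put $\widehat{V}=\big(\phi_1^{n+V_2}-\beta_1\,\phi_2^{n+V_2}\big)[V_1]_{\mathcal{R}(p,q)}$ and $\overline{V}=[V_2]_{\mathcal{R}(p,q)}$. Then $$\mathrm{Cov}\big(\widehat{V},\overline{V}\big)=\frac{[n]_{\mathcal{R}(p,q)}\,\beta_1\beta_2}{\phi_1^{n}-\beta_2\phi_2^{n}}\left(\frac{[n+1]_{\mathcal{R}(p,q)}}{\phi_1^{n+1}-\beta_2\phi_2^{n+1}}-\frac{[n]_{\mathcal{R}(p,q)}}{\phi_1^{n}-\beta_2\phi_2^{n}}\right).$$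
   Context: Let $0<q<p<1$ be real numbers and let $\mathcal{R}(u,v)=\sum_{s,t=-l}^{\infty}r_{st}u^sv^t$ ($r_{st}\in\mathbb{C}$, $l\in\mathbb{N}\cup\{0\}$) be a meromorphic function on $\mathbb{C}\times\mathbb{C}$ with $\mathcal{R}(p^n,q^n)>0$ for all $n\in\mathbb{N}$ and $\mathcal{R}(1,1)=0$. The $\mathcal{R}(p,q)$-deformed numbers are $[n]_{\mathcal{R}(p,q)}=\mathcal{R}(p^n,q^n)$, and it is assumed that they can be written as $[n]_{\mathcal{R}(p,q)}=\frac{\phi_1^n-\phi_2^n}{\phi_1-\phi_2}$, where $\phi_1\ne\phi_2$ are functions of the deformation parameters $p,q$. Factorials: $[0]!_{\mathcal{R}(p,q)}=1$ and $[n]!_{\mathcal{R}(p,q)}=\prod_{i=1}^{n}[i]_{\mathcal{R}(p,q)}$. Trinomial coefficient: $\begin{bmatrix} N\\ a,b\end{bmatrix}_{\mathcal{R}(p,q)}=\frac{[N]!_{\mathcal{R}(p,q)}}{[a]!_{\mathcal{R}(p,q)}[b]!_{\mathcal{R}(p,q)}[N-a-b]!_{\mathcal{R}(p,q)}}$. Shifted factorial: $(u\ominus v)^n_{\mathcal{R}(p,q)}=\prod_{i=1}^{n}(u\phi_1^{i-1}-v\phi_2^{i-1})$, with $(u\ominus v)^0_{\mathcal{R}(p,q)}=1$. The covariance is $\mathrm{Cov}(A,B)=E(AB)-E(A)E(B)$.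
   Formalization: The formal theorem additionally assumes that the mass function is strictly positive at every pair (v1,v2), which excludes vanishing factors φ1^k − β1 φ2^k; without this the covariance formula can fail. *)

theory Defs
  imports "HOL-Probability.Probability"
begin

text \<open>
  Functions of two complex variables are functions on \<^typ>\<open>complex \<times> complex\<close>; holomorphic means
  that the real Frechet derivative exists and is complex linear.
\<close>

definition holomorphic2_on :: "(complex \<times> complex \<Rightarrow> complex) \<Rightarrow> (complex \<times> complex) set \<Rightarrow> bool" where
  "holomorphic2_on f U \<longleftrightarrow>
     (\<forall>z\<in>U. \<exists>a b. (f has_derivative (\<lambda>w. a * fst w + b * snd w)) (at z))"

text \<open>
  Locally a quotient of holomorphic functions whose denominator vanishes on no nonempty open set.
  As with \<^const>\<open>inverse\<close> at \<open>0\<close>, nothing is said about values where every local denominator vanishes.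
\<close>

definition meromorphic2 :: "(complex \<times> complex \<Rightarrow> complex) \<Rightarrow> bool" where
  "meromorphic2 R \<longleftrightarrow>
     (\<forall>z. \<exists>U g h. open U \<and> z \<in> U \<and> holomorphic2_on g U \<and> holomorphic2_on h U \<and>
        U \<subseteq> closure {w \<in> U. h w \<noteq> 0} \<and> (\<forall>w\<in>U. h w \<noteq> 0 \<longrightarrow> R w = g w / h w))"

text \<open>
  The expansion is required near the origin, off the axes; elsewhere \<open>R\<close> is tied to it by
  meromorphic continuation, so poles away from the axes are allowed.
\<close>

definition has_laurent_expansion2 ::
    "(complex \<times> complex \<Rightarrow> complex) \<Rightarrow> (int \<Rightarrow> int \<Rightarrow> complex) \<Rightarrow> nat \<Rightarrow> bool" where
  "has_laurent_expansion2 R r l \<longleftrightarrow>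
     (\<exists>\<rho>>0. \<forall>u v. u \<noteq> 0 \<and> norm u < \<rho> \<and> v \<noteq> 0 \<and> norm v < \<rho> \<longrightarrow>
        ((\<lambda>(s, t). r s t * u powi s * v powi t) has_sum R (u, v)) ({- int l..} \<times> {- int l..}))"

text \<open>
  The number \<open>[n]\<close> attached to \<open>R\<close>, \<open>p\<close>, \<open>q\<close>. It is used only where the value of \<open>R\<close> is real, so
  that \<^const>\<open>Re\<close> is merely the coercion to the reals.
\<close>

definition deformed_num :: "(complex \<times> complex \<Rightarrow> complex) \<Rightarrow> real \<Rightarrow> real \<Rightarrow> nat \<Rightarrow> real" where
  "deformed_num R p q n = Re (R (complex_of_real (p ^ n), complex_of_real (q ^ n)))"

definition deformed_fact :: "(complex \<times> complex \<Rightarrow> complex) \<Rightarrow> real \<Rightarrow> real \<Rightarrow> nat \<Rightarrow> real" where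
  "deformed_fact R p q n = (\<Prod>i=1..n. deformed_num R p q i)"

definition deformed_trinomial ::
    "(complex \<times> complex \<Rightarrow> complex) \<Rightarrow> real \<Rightarrow> real \<Rightarrow> nat \<Rightarrow> nat \<Rightarrow> nat \<Rightarrow> real" where
  "deformed_trinomial R p q N a b =
     deformed_fact R p q N /
     (deformed_fact R p q a * deformed_fact R p q b * deformed_fact R p q (N - a - b))"

text \<open>\<open>(u \<ominus> v)\<^sup>n\<close>, with \<open>\<phi>1\<close> and \<open>\<phi>2\<close> the values of the structure functions at the given \<open>(p, q)\<close>.\<close>

definition shifted_fact :: "real \<Rightarrow> real \<Rightarrow> real \<Rightarrow> real \<Rightarrow> nat \<Rightarrow> real" where
  "shifted_fact \<phi>1 \<phi>2 u v n = (\<Prod>i=1..n. u * \<phi>1 ^ (i - 1) - v * \<phi>2 ^ (i - 1))"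

definition neg_trinomial2_mass ::
    "(complex \<times> complex \<Rightarrow> complex) \<Rightarrow> real \<Rightarrow> real \<Rightarrow> real \<Rightarrow> real \<Rightarrow>
     nat \<Rightarrow> real \<Rightarrow> real \<Rightarrow> nat \<Rightarrow> nat \<Rightarrow> real" where
  "neg_trinomial2_mass R p q \<phi>1 \<phi>2 n \<beta>1 \<beta>2 v1 v2 =
     deformed_trinomial R p q (n + v1 + v2 - 1) v1 v2 * \<beta>1 ^ v1 * \<beta>2 ^ v2 *
     shifted_fact \<phi>1 \<phi>2 1 \<beta>1 (n + v2) * shifted_fact \<phi>1 \<phi>2 1 \<beta>2 n"

definition covariance :: "'a measure \<Rightarrow> ('a \<Rightarrow> real) \<Rightarrow> ('a \<Rightarrow> real) \<Rightarrow> real" where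
  "covariance M A B = (LINT x|M. A x * B x) - (LINT x|M. A x) * (LINT x|M. B x)"

end

theory Submission
  imports Defs
begin

text \<open>
  Multiplying the mass function by \<open>[v\<^sub>2]\<close> cancels the last factor of \<open>[v\<^sub>2]!\<close>, and after shifting
  \<open>v\<^sub>2\<close> by one what is left is a constant times the mass function with \<open>n + 1\<close> in place of \<open>n\<close>
  (\<open>mass_shift_snd\<close>). The random factor of the statistic built from \<open>V\<^sub>1\<close> is exactly the one that
  does the same for \<open>v\<^sub>1\<close> (\<open>mass_shift_fst\<close>). So all three expectations are explicit constants
  times the total masses of the distributions with parameters \<open>n + 1\<close> and \<open>n + 2\<close>, and the formula
  holds once these totals are \<open>1\<close>.

  A priori only the total for \<open>n\<close> itself is \<open>1\<close>. The point of the proof is that the existence of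
  the distribution forces \<open>\<phi>\<^sub>1 = 1\<close>, which makes the totals for all parameters equal to \<open>1\<close>.
  Let \<open>g\<^sub>j(x)\<close> be the sum over \<open>k\<close> of the deformed binomial coefficients \<open>[j + k choose k]\<close> times
  \<open>x\<^sup>k\<close>. The deformed Pascal rule gives
  \<open>(1 - \<phi>\<^sub>2\<^sup>j\<^sup>+\<^sup>1 x) g\<^sub>j\<^sub>+\<^sub>1(x) = g\<^sub>j(\<phi>\<^sub>1 x)\<close>.
  Positivity of the masses yields \<open>\<bar>\<phi>\<^sub>2\<bar> < \<phi>\<^sub>1\<close> (\<open>mass_pos_imp_dominant\<close>). Then:

  \<^item> If \<open>\<phi>\<^sub>1 > 1\<close>, convergence of \<open>g\<^sub>j\<close> at \<open>x\<close> propagates through the recursion to convergence of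
    a geometric series with ratio \<open>\<phi>\<^sub>1\<^sup>j x\<close>, which fails for large \<open>j\<close>. But the slice \<open>V\<^sub>2 = v\<^sub>2\<close> of the
    distribution is a multiple of \<open>g\<^sub>j(\<beta>\<^sub>1)\<close> with \<open>j = n + v\<^sub>2 - 1\<close>, so all of them converge
    (\<open>summable_slices_imp_small\<close>).

  \<^item> If \<open>\<phi>\<^sub>1 \<le> 1\<close>, the normalised series \<open>(1 \<ominus> x)\<^sup>j\<^sup>+\<^sup>1 g\<^sub>j(x)\<close> starts at \<open>1\<close> for \<open>j = 0\<close> and decreases
    with \<open>j\<close>, strictly if \<open>\<phi>\<^sub>1 < 1\<close> (\<open>neg_binomial_mass_Suc\<close>). Hence \<open>\<phi>\<^sub>1 < 1\<close> would make the
    trinomial total less than \<open>1\<close> (\<open>mass_iterated_sums_less_1\<close>), while for \<open>\<phi>\<^sub>1 = 1\<close> the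
    normalised series is constantly \<open>1\<close> and all the trinomial totals are \<open>1\<close>
    (\<open>mass_iterated_sums_1\<close>).
\<close>

section \<open>Iterated sums and expectations of functions of two discrete variables\<close>

text \<open>
  The inner sum runs over \<open>v1\<close> because, for fixed \<open>v2\<close>, the trinomial masses form a univariate
  negative binomial series in \<open>v1\<close>.
\<close>

definition iterated_sums :: "(nat \<Rightarrow> nat \<Rightarrow> real) \<Rightarrow> real \<Rightarrow> bool" where
  "iterated_sums f s \<longleftrightarrow> (\<exists>a. (\<forall>v2. (\<lambda>v1. f v1 v2) sums a v2) \<and> a sums s)"

lemma iterated_sums_mult:
  assumes "iterated_sums f s"
  shows "iterated_sums (\<lambda>v1 v2. c * f v1 v2) (c * s)"
proof -
  obtain a where "\<And>v2. (\<lambda>v1. f v1 v2) sums a v2" "a sums s"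
    using assms by (auto simp: iterated_sums_def)
  then show ?thesis
    unfolding iterated_sums_def
    by (intro exI[of _ "\<lambda>v2. c * a v2"] conjI allI sums_mult)
qed

lemma iterated_sums_shift_fst:
  assumes "iterated_sums (\<lambda>v1 v2. f (Suc v1) v2) s" and "\<And>v2. f 0 v2 = 0"
  shows "iterated_sums f s"
proof -
  have "(\<lambda>v1. f (Suc v1) v2) sums a \<longleftrightarrow> (\<lambda>v1. f v1 v2) sums a" for v2 a
    using assms(2) sums_Suc_iff[of "\<lambda>v1. f v1 v2" a] by simp
  then show ?thesis
    using assms(1) by (simp add: iterated_sums_def)
qed

lemma iterated_sums_shift_snd:
  assumes "iterated_sums (\<lambda>v1 v2. f v1 (Suc v2)) s" and "\<And>v1. f v1 0 = 0"
  shows "iterated_sums f s"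
proof -
  obtain a where a: "\<And>v2. (\<lambda>v1. f v1 (Suc v2)) sums a v2" "a sums s"
    using assms(1) by (auto simp: iterated_sums_def)
  define b where "b = case_nat 0 a"
  have "(\<lambda>v1. f v1 v2) sums b v2" for v2
    using a(1) assms(2) by (cases v2) (auto simp: b_def)
  moreover have "b sums s"
    using a(2) sums_Suc_iff[of b s] by (simp add: b_def)
  ultimately show ?thesis
    by (auto simp: iterated_sums_def)
qed

lemma suminf_ennreal_single:
  "(\<Sum>k. if k = i then f k else (0::ennreal)) = f i"
  using sums_single[of i f] by (simp add: sums_iff)

lemma nn_integral_two_nat_valued:
  assumes [measurable]: "V1 \<in> measurable M (count_space UNIV)" "V2 \<in> measurable M (count_space UNIV)"
  shows "(\<integral>\<^sup>+x. g (V1 x) (V2 x) \<partial>M) =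
    (\<Sum>v2. \<Sum>v1. g v1 v2 * emeasure M {x \<in> space M. V1 x = v1 \<and> V2 x = v2})"
proof -
  let ?S = "\<lambda>v1 v2. {x \<in> space M. V1 x = v1 \<and> V2 x = v2}"
  have pt: "g (V1 x) (V2 x) = (\<Sum>v2. \<Sum>v1. g v1 v2 * indicator (?S v1 v2) x)"
    if "x \<in> space M" for x
  proof -
    have "(\<Sum>v1. g v1 v2 * indicator (?S v1 v2) x) = (if v2 = V2 x then g (V1 x) v2 else 0)" for v2
    proof -
      have "(\<lambda>v1. g v1 v2 * indicator (?S v1 v2) x) =
          (\<lambda>v1. if v1 = V1 x then (if v2 = V2 x then g v1 v2 else 0) else 0)"
        using that by (auto simp: indicator_def)
      then show ?thesis
        by (simp only: suminf_ennreal_single)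
    qed
    then show ?thesis
      by (simp only: suminf_ennreal_single)
  qed
  have "(\<integral>\<^sup>+x. g (V1 x) (V2 x) \<partial>M) = (\<integral>\<^sup>+x. (\<Sum>v2. \<Sum>v1. g v1 v2 * indicator (?S v1 v2) x) \<partial>M)"
    by (rule nn_integral_cong) (rule pt)
  also have "\<dots> = (\<Sum>v2. \<Sum>v1. \<integral>\<^sup>+x. g v1 v2 * indicator (?S v1 v2) x \<partial>M)"
    by (simp add: nn_integral_suminf)
  finally show ?thesis
    by (simp add: nn_integral_cmult_indicator)
qed

text \<open>
  As \<open>g\<close> is nonnegative, the order of summation is immaterial, and finiteness of the iterated sum
  already gives integrability.
\<close>

lemma has_bochner_integral_two_nat_valued:
  fixes g :: "nat \<Rightarrow> nat \<Rightarrow> real"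
  assumes "finite_measure M"
    and V [measurable]: "V1 \<in> measurable M (count_space UNIV)" "V2 \<in> measurable M (count_space UNIV)"
    and g: "\<And>v1 v2. 0 \<le> g v1 v2"
    and sums: "iterated_sums
      (\<lambda>v1 v2. g v1 v2 * measure M {x \<in> space M. V1 x = v1 \<and> V2 x = v2}) s"
  shows "has_bochner_integral M (\<lambda>x. g (V1 x) (V2 x)) s"
proof -
  interpret finite_measure M by fact
  let ?f = "\<lambda>v1 v2. g v1 v2 * measure M {x \<in> space M. V1 x = v1 \<and> V2 x = v2}"
  obtain a where a: "\<And>v2. (\<lambda>v1. ?f v1 v2) sums a v2" "a sums s"
    using sums by (auto simp: iterated_sums_def)
  have f: "0 \<le> ?f v1 v2" for v1 v2
    using g by simp
  have a0: "0 \<le> a v2" for v2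
    using f by (rule sums_le[OF _ sums_zero a(1)])
  have s0: "0 \<le> s"
    using a0 by (rule sums_le[OF _ sums_zero a(2)])
  have "(\<integral>\<^sup>+x. ennreal (g (V1 x) (V2 x)) \<partial>M) = (\<Sum>v2. \<Sum>v1. ennreal (?f v1 v2))"
    using g by (subst nn_integral_two_nat_valued[OF V]) (simp add: emeasure_eq_measure ennreal_mult)
  also have "\<dots> = (\<Sum>v2. ennreal (a v2))"
    using suminf_ennreal_eq[OF f a(1)] by simp
  also have "\<dots> = ennreal s"
    using suminf_ennreal_eq[OF a0 a(2)] by simp
  finally show ?thesis
    using g s0 by (intro has_bochner_integral_nn_integral) auto
qed

lemma summable_slice_measure:
  assumes "finite_measure M"
    and [measurable]: "V1 \<in> measurable M (count_space UNIV)" "V2 \<in> measurable M (count_space UNIV)"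
  shows "summable (\<lambda>v1::nat. measure M {x \<in> space M. V1 x = v1 \<and> V2 x = (v2::nat)})"
proof -
  interpret finite_measure M by fact
  show ?thesis
    by (rule sums_summable, rule finite_measure_UNION) (auto simp: disjoint_family_on_def)
qed

section \<open>Deformed binomial series\<close>

text \<open>
  The solution of the recurrence is the Cauchy product of \<open>b\<close> with the geometric series of ratio
  \<open>c\<close>. Passing through the product gives convergence of \<open>f\<close> and its sum at the same time,
  whatever the sign of \<open>c\<close>.
\<close>

lemma first_order_recurrence_sums:
  fixes f b :: "nat \<Rightarrow> real"
  assumes zero: "f 0 = b 0" and step: "\<And>k. f (Suc k) = b (Suc k) + c * f k"
    and c: "\<bar>c\<bar> < 1" and nonneg: "\<And>k. 0 \<le> b k" and b: "summable b"
  shows "f sums (suminf b / (1 - c))"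
proof -
  have "f k = (\<Sum>i\<le>k. b i * c ^ (k - i))" for k
  proof (induction k)
    case (Suc k)
    have "(\<Sum>i\<le>k. b i * c ^ (Suc k - i)) = c * (\<Sum>i\<le>k. b i * c ^ (k - i))"
      by (auto simp: sum_distrib_left Suc_diff_le intro!: sum.cong)
    then show ?case
      using Suc step by simp
  qed (simp add: zero)
  then have "f = (\<lambda>k. \<Sum>i\<le>k. b i * c ^ (k - i))" by auto
  moreover have "(\<lambda>k. \<Sum>i\<le>k. b i * c ^ (k - i)) sums (suminf b * (\<Sum>k. c ^ k))"
    using b c nonneg by (intro Cauchy_product_sums) (auto simp: power_abs intro: summable_geometric)
  ultimately show ?thesis
    using c by (simp add: suminf_geometric)
qed

locale deformed_numbers =
  fixes R :: "complex \<times> complex \<Rightarrow> complex" and p q \<phi>1 \<phi>2 :: real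
  assumes distinct: "\<phi>1 \<noteq> \<phi>2"
    and num_eq: "\<And>k. deformed_num R p q k = (\<phi>1 ^ k - \<phi>2 ^ k) / (\<phi>1 - \<phi>2)"
    and num_pos: "\<And>k. 0 < k \<Longrightarrow> 0 < deformed_num R p q k"
begin

abbreviation num :: "nat \<Rightarrow> real" where "num \<equiv> deformed_num R p q"
abbreviation fct :: "nat \<Rightarrow> real" where "fct \<equiv> deformed_fact R p q"
abbreviation sft :: "real \<Rightarrow> nat \<Rightarrow> real" where "sft \<equiv> shifted_fact \<phi>1 \<phi>2 1"

text \<open>
  The deformed \<open>j + k\<close> choose \<open>k\<close>; this indexing avoids truncated subtraction and makes the
  coefficient symmetric in its arguments.
\<close>

definition binom :: "nat \<Rightarrow> nat \<Rightarrow> real" where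
  "binom j k = fct (j + k) / (fct j * fct k)"

definition binom_series :: "nat \<Rightarrow> real \<Rightarrow> real" where
  "binom_series j x = (\<Sum>k. binom j k * x ^ k)"

lemma num_0 [simp]: "num 0 = 0"
  by (simp add: num_eq)

lemma num_nonneg [simp]: "0 \<le> num k"
  using num_pos[of k] by (cases "k = 0") auto

lemma fct_0 [simp]: "fct 0 = 1"
  by (simp add: deformed_fact_def)

lemma fct_Suc [simp]: "fct (Suc k) = fct k * num (Suc k)"
  by (simp add: deformed_fact_def)

lemma sft_0 [simp]: "sft x 0 = 1"
  by (simp add: shifted_fact_def)

lemma sft_Suc [simp]: "sft x (Suc k) = sft x k * (\<phi>1 ^ k - x * \<phi>2 ^ k)"
  by (simp add: shifted_fact_def)

lemma fct_pos [simp]: "0 < fct k"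
  by (induction k) (simp_all add: num_pos)

lemma fct_nonzero [simp]: "fct k \<noteq> 0"
  using fct_pos[of k] by linarith

lemma num_Suc_nonzero [simp]: "num (Suc k) \<noteq> 0"
  using num_pos[of "Suc k"] by simp

lemma binom_pos: "0 < binom j k"
  by (simp add: binom_def)

lemma binom_0 [simp]: "binom 0 k = 1" "binom j 0 = 1"
  by (simp_all add: binom_def)

text \<open>
  One of the two ways of splitting \<open>\<phi>\<^sub>1\<^sup>j\<^sup>+\<^sup>k - \<phi>\<^sub>2\<^sup>j\<^sup>+\<^sup>k\<close>; it puts \<open>\<phi>\<^sub>1\<close> next to the power that will be
  absorbed into the argument of the series.
\<close>

lemma num_add: "num (j + k) = \<phi>1 ^ k * num j + \<phi>2 ^ j * num k"
proof -
  have "\<phi>1 ^ (j + k) - \<phi>2 ^ (j + k) = \<phi>1 ^ k * (\<phi>1 ^ j - \<phi>2 ^ j) + \<phi>2 ^ j * (\<phi>1 ^ k - \<phi>2 ^ k)"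
    by (simp add: algebra_simps power_add)
  then show ?thesis
    by (simp add: num_eq add_divide_distrib)
qed

lemma binom_Suc_Suc:
  "binom (Suc j) (Suc k) = \<phi>1 ^ Suc k * binom j (Suc k) + \<phi>2 ^ Suc j * binom (Suc j) k"
proof -
  have "binom (Suc j) (Suc k) = fct (Suc (j + k)) * num (Suc j + Suc k) / (fct (Suc j) * fct (Suc k))"
    by (simp add: binom_def)
  also have "\<dots> = \<phi>1 ^ Suc k * (fct (Suc (j + k)) * num (Suc j) / (fct (Suc j) * fct (Suc k))) +
      \<phi>2 ^ Suc j * (fct (Suc (j + k)) * num (Suc k) / (fct (Suc j) * fct (Suc k)))"
    unfolding num_add by (simp add: field_simps del: fct_Suc)
  also have "fct (Suc (j + k)) * num (Suc j) / (fct (Suc j) * fct (Suc k)) = binom j (Suc k)"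
    by (simp add: binom_def)
  also have "fct (Suc (j + k)) * num (Suc k) / (fct (Suc j) * fct (Suc k)) = binom (Suc j) k"
    by (simp add: binom_def)
  finally show ?thesis .
qed

lemma binom_term_Suc:
  "binom (Suc j) (Suc k) * x ^ Suc k =
     binom j (Suc k) * (\<phi>1 * x) ^ Suc k + \<phi>2 ^ Suc j * x * (binom (Suc j) k * x ^ k)"
  unfolding binom_Suc_Suc by (simp add: algebra_simps)

text \<open>
  If the series of index \<open>j + 1\<close> converges at \<open>x\<close>, the Pascal rule writes the terms of the series of
  index \<open>j\<close> at \<open>\<phi>\<^sub>1 x\<close> as differences of summable terms. After \<open>j\<close> such steps a convergent geometric
  series of ratio \<open>\<phi>\<^sub>1\<^sup>j x\<close> remains.
\<close>

lemma binom_series_convergent_imp: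
  assumes "summable (\<lambda>k. binom j k * x ^ k)" and "0 < x" and "0 < \<phi>1"
  shows "\<phi>1 ^ j * x < 1"
  using assms
proof (induction j arbitrary: x)
  case 0
  then show ?case by simp
next
  case (Suc j)
  let ?f = "\<lambda>k. binom (Suc j) k * x ^ k"
  have "summable (\<lambda>k. ?f (Suc k) - \<phi>2 ^ Suc j * x * ?f k)"
    using Suc.prems(1) summable_Suc_iff[of ?f] by (intro summable_diff summable_mult) blast+
  then have "summable (\<lambda>k. binom j (Suc k) * (\<phi>1 * x) ^ Suc k)"
    unfolding binom_term_Suc by simp
  then have "summable (\<lambda>k. binom j k * (\<phi>1 * x) ^ k)"
    using summable_Suc_iff[of "\<lambda>k. binom j k * (\<phi>1 * x) ^ k"] by blast
  then show ?case
    using Suc.IH[of "\<phi>1 * x"] Suc.prems by (simp add: algebra_simps)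
qed

end

text \<open>
  The range of structure functions in which every binomial series converges on \<open>[0, 1)\<close> and the
  shifted factorials \<open>(1 \<ominus> x)\<close> are positive there.
\<close>

locale small_deformed_numbers = deformed_numbers +
  assumes dominant: "\<bar>\<phi>2\<bar> < \<phi>1" and small: "\<phi>1 \<le> 1"
begin

lemma phi2_scaled_less_1:
  assumes "0 \<le> x" "x < 1"
  shows "\<bar>\<phi>2 ^ j * x\<bar> < 1"
proof -
  have "\<bar>\<phi>2\<bar> ^ j \<le> 1"
    using dominant small by (intro power_le_one) auto
  then have "\<bar>\<phi>2\<bar> ^ j * x \<le> 1 * x"
    using assms by (intro mult_right_mono) auto
  then show ?thesis
    using assms by (simp add: abs_mult power_abs)
qed

lemma scaled_argument:
  assumes "0 \<le> x" "x < 1"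
  shows "0 \<le> \<phi>1 * x" "\<phi>1 * x < 1" "\<phi>1 * x \<le> x"
proof -
  show "0 \<le> \<phi>1 * x" using assms dominant by simp
  show "\<phi>1 * x \<le> x" using assms small dominant by (intro mult_left_le_one_le) auto
  with assms show "\<phi>1 * x < 1" by simp
qed

lemma binom_series_step:
  assumes "0 \<le> x" "x < 1" and "summable (\<lambda>k. binom j k * (\<phi>1 * x) ^ k)"
  shows "(\<lambda>k. binom (Suc j) k * x ^ k) sums (binom_series j (\<phi>1 * x) / (1 - \<phi>2 ^ Suc j * x))"
  unfolding binom_series_def
  using assms scaled_argument[of x] phi2_scaled_less_1[of x "Suc j"] binom_pos
  by (intro first_order_recurrence_sums binom_term_Suc) (auto simp: less_imp_le)

lemma binom_series_summable:
  assumes "0 \<le> x" "x < 1"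
  shows "summable (\<lambda>k. binom j k * x ^ k)"
  using assms
proof (induction j arbitrary: x)
  case (Suc j)
  then show ?case
    using binom_series_step[of x j] scaled_argument[of x] by (blast intro: sums_summable)
qed (simp add: summable_geometric)

lemma binom_series_Suc:
  assumes "0 \<le> x" "x < 1"
  shows "binom_series (Suc j) x * (1 - \<phi>2 ^ Suc j * x) = binom_series j (\<phi>1 * x)"
proof -
  have "binom_series (Suc j) x = binom_series j (\<phi>1 * x) / (1 - \<phi>2 ^ Suc j * x)"
    using binom_series_step[of x j] binom_series_summable[of "\<phi>1 * x" j] scaled_argument[of x] assms
    unfolding binom_series_def[of "Suc j"] by (simp add: sums_iff)
  then show ?thesis
    using phi2_scaled_less_1[OF assms, of "Suc j"] by (auto simp: field_simps)
qed

lemma sft_pos: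
  assumes "0 \<le> x" "x < 1"
  shows "0 < sft x k" and "0 < \<phi>1 ^ k - x * \<phi>2 ^ k"
proof -
  have factor: "0 < \<phi>1 ^ i - x * \<phi>2 ^ i" for i
  proof -
    have "x * \<phi>2 ^ i \<le> x * \<bar>\<phi>2\<bar> ^ i"
      using assms by (intro mult_left_mono) (auto simp: power_abs[symmetric])
    also have "\<dots> \<le> x * \<phi>1 ^ i"
      using assms dominant by (intro mult_left_mono power_mono) auto
    also have "\<dots> < \<phi>1 ^ i"
      using assms dominant by (simp add: mult_less_cancel_right1)
    finally show ?thesis by simp
  qed
  then show "0 < \<phi>1 ^ k - x * \<phi>2 ^ k" .
  show "0 < sft x k"
    using factor by (induction k) (auto intro!: mult_pos_pos)
qed

text \<open>
  The total mass of the univariate negative binomial distribution of the second kind with \<open>j + 1\<close>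
  successes.
\<close>

definition neg_binomial_mass :: "nat \<Rightarrow> real \<Rightarrow> real" where
  "neg_binomial_mass j x = sft x (Suc j) * binom_series j x"

lemma neg_binomial_mass_sums:
  assumes "0 \<le> x" "x < 1"
  shows "(\<lambda>k. sft x (Suc j) * (binom j k * x ^ k)) sums neg_binomial_mass j x"
  unfolding neg_binomial_mass_def binom_series_def
  using binom_series_summable[OF assms] by (intro sums_mult) (simp add: summable_sums)

lemma binom_series_pos:
  assumes "0 \<le> x" "x < 1"
  shows "0 < binom_series j x"
  unfolding binom_series_def
  using assms binom_pos by (intro suminf_pos2[of _ 0] binom_series_summable) (auto simp: less_imp_le)

lemma neg_binomial_mass_0:
  assumes "0 \<le> x" "x < 1"
  shows "neg_binomial_mass 0 x = 1"
  using assms by (simp add: neg_binomial_mass_def binom_series_def suminf_geometric)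

text \<open>
  The new factor \<open>\<phi>\<^sub>1\<^sup>j\<^sup>+\<^sup>1 - x \<phi>\<^sub>2\<^sup>j\<^sup>+\<^sup>1\<close> of the shifted factorial falls short of the factor
  \<open>1 - x \<phi>\<^sub>2\<^sup>j\<^sup>+\<^sup>1\<close> in the series recursion by \<open>1 - \<phi>\<^sub>1\<^sup>j\<^sup>+\<^sup>1\<close>, and replacing \<open>x\<close> by \<open>\<phi>\<^sub>1 x\<close> lowers the
  series further. Both losses vanish when \<open>\<phi>\<^sub>1 = 1\<close>, and the first is strict when \<open>\<phi>\<^sub>1 < 1\<close>.
\<close>

lemma neg_binomial_mass_Suc:
  assumes "0 \<le> x" "x < 1"
  shows "neg_binomial_mass (Suc j) x \<le> neg_binomial_mass j x"
    and "\<phi>1 < 1 \<Longrightarrow> neg_binomial_mass (Suc j) x < neg_binomial_mass j x"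
proof -
  have S: "0 < sft x (Suc j)" "0 < binom_series (Suc j) x"
    using sft_pos[OF assms] binom_series_pos[OF assms] by blast+
  have mono: "binom_series j (\<phi>1 * x) \<le> binom_series j x"
    unfolding binom_series_def using assms scaled_argument[OF assms] binom_pos
    by (intro suminf_le mult_left_mono power_mono binom_series_summable) (auto simp: less_imp_le)
  have eq: "neg_binomial_mass (Suc j) x =
      sft x (Suc j) * (binom_series j (\<phi>1 * x) - binom_series (Suc j) x * (1 - \<phi>1 ^ Suc j))"
    unfolding binom_series_Suc[OF assms, symmetric] neg_binomial_mass_def
    by (simp add: algebra_simps)
  have "0 \<le> 1 - \<phi>1 ^ Suc j"
    using dominant small power_le_one[of \<phi>1 "Suc j"] by simp
  then show "neg_binomial_mass (Suc j) x \<le> neg_binomial_mass j x"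
    unfolding eq neg_binomial_mass_def[of j] using S mono
    by (intro mult_left_mono) (auto simp: less_imp_le intro!: order_trans[OF _ mono])
  assume "\<phi>1 < 1"
  then have "0 < 1 - \<phi>1 ^ Suc j"
    using dominant power_Suc_less_one[of \<phi>1 j] by simp
  then have "0 < binom_series (Suc j) x * (1 - \<phi>1 ^ Suc j)"
    using S by (intro mult_pos_pos) auto
  then show "neg_binomial_mass (Suc j) x < neg_binomial_mass j x"
    unfolding eq neg_binomial_mass_def[of j] using S mono by (intro mult_strict_left_mono) auto
qed

lemma neg_binomial_mass_le_1:
  assumes "0 \<le> x" "x < 1"
  shows "neg_binomial_mass j x \<le> 1"
  by (induction j) (use neg_binomial_mass_0[OF assms] neg_binomial_mass_Suc[OF assms] in \<open>auto intro: order_trans\<close>)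

lemma neg_binomial_mass_less_1:
  assumes "0 \<le> x" "x < 1" "\<phi>1 < 1"
  shows "neg_binomial_mass (Suc j) x < 1"
  using neg_binomial_mass_Suc(2)[OF assms, of j] neg_binomial_mass_le_1[OF assms(1,2), of j] by linarith

lemma neg_binomial_mass_eq_1:
  assumes "0 \<le> x" "x < 1" "\<phi>1 = 1"
  shows "neg_binomial_mass j x = 1"
proof (induction j)
  case (Suc j)
  then show ?case
    using binom_series_Suc[OF assms(1,2), of j] \<open>\<phi>1 = 1\<close>
    unfolding neg_binomial_mass_def sft_Suc[of _ "Suc j"]
    by (simp add: mult.assoc mult.commute[of x]
        mult.commute[of "binom_series (Suc j) x"] del: sft_Suc)
qed (use neg_binomial_mass_0 assms in simp)

end

section \<open>The trinomial mass function\<close>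

context deformed_numbers
begin

abbreviation mass where "mass \<equiv> neg_trinomial2_mass R p q \<phi>1 \<phi>2"

lemma mass_Suc:
  "mass (Suc j) \<beta>1 \<beta>2 v1 v2 = fct (j + v1 + v2) / (fct v1 * fct v2 * fct j) * \<beta>1 ^ v1 * \<beta>2 ^ v2 *
     sft \<beta>1 (Suc (j + v2)) * sft \<beta>2 (Suc j)"
proof -
  have "Suc j + v1 + v2 - 1 = j + v1 + v2" "j + v1 + v2 - v1 - v2 = j" by simp_all
  then show ?thesis
    by (simp only: neg_trinomial2_mass_def deformed_trinomial_def add_Suc)
qed

text \<open>
  This reduces everything to one variable: the first factor is a negative binomial mass in \<open>v2\<close> with
  \<open>j + 1\<close> successes, the second one in \<open>v1\<close> with \<open>j + 1 + v2\<close> successes, each with its own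
  normalising shifted factorial.
\<close>

lemma mass_factorised:
  "mass (Suc j) \<beta>1 \<beta>2 v1 v2 =
     (sft \<beta>2 (Suc j) * (binom j v2 * \<beta>2 ^ v2)) *
     (sft \<beta>1 (Suc (j + v2)) * (binom (j + v2) v1 * \<beta>1 ^ v1))"
proof -
  have algebra: "F / (A * B * J) * X * Y * S * T = (T * (G / (J * B) * Y)) * (S * (F / (G * A) * X))"
    if "G \<noteq> 0" for F A B J X Y S T G :: real
    using that by (simp add: mult_ac)
  have "j + v1 + v2 = j + v2 + v1" by simp
  then show ?thesis
    using algebra[OF fct_nonzero[of "j + v2"]] by (simp only: mass_Suc binom_def)
qed

lemma mass_shift_snd:
  assumes "0 < n" and "\<phi>1 ^ n - \<beta>2 * \<phi>2 ^ n \<noteq> 0"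
  shows "num (Suc v2) * mass n \<beta>1 \<beta>2 v1 (Suc v2) =
    num n * \<beta>2 / (\<phi>1 ^ n - \<beta>2 * \<phi>2 ^ n) * mass (Suc n) \<beta>1 \<beta>2 v1 v2"
proof -
  obtain j where n: "n = Suc j" using assms(1) by (cases n) auto
  \<comment> \<open>The identity for opaque factors: \<open>N\<close>, \<open>K\<close> are the numbers split off from the factorials and \<open>c\<close>
    is the last factor of \<open>(1 \<ominus> \<beta>2)\<close> with exponent \<open>n + 1\<close>.\<close>
  have algebra: "N * (F / (A * (B * N) * J) * X * (b * Y) * S * T) =
      K * b / c * (F / (A * B * (J * K)) * X * Y * S * (T * c))"
    if "N \<noteq> 0" "K \<noteq> 0" "c \<noteq> 0" for N F A B J X b Y S T K c :: real
    using that by (simp add: divide_simps)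
  show ?thesis
    using algebra[OF num_Suc_nonzero num_Suc_nonzero assms(2)] unfolding n
    by (simp only: mass_Suc add_Suc add_Suc_right fct_Suc[of v2] fct_Suc[of j]
        sft_Suc[of \<beta>2 "Suc j"] power_Suc[of \<beta>2 v2])
qed

lemma mass_shift_fst:
  assumes "0 < n" and "\<phi>1 ^ n - \<beta>2 * \<phi>2 ^ n \<noteq> 0"
  shows "(\<phi>1 ^ (n + v2) - \<beta>1 * \<phi>2 ^ (n + v2)) * num (Suc v1) * mass n \<beta>1 \<beta>2 (Suc v1) v2 =
    num n * \<beta>1 / (\<phi>1 ^ n - \<beta>2 * \<phi>2 ^ n) * mass (Suc n) \<beta>1 \<beta>2 v1 v2"
proof -
  obtain j where n: "n = Suc j" using assms(1) by (cases n) auto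
  \<comment> \<open>As for \<open>v2\<close>, with \<open>d\<close> the last factor of \<open>(1 \<ominus> \<beta>1)\<close> with exponent \<open>n + 1 + v2\<close>: it has to be
    supplied here, whereas shifting \<open>v2\<close> changes that exponent by itself.\<close>
  have algebra: "d * N * (F / (A * N * B * J) * (b * X) * Y * S * T) =
      K * b / c * (F / (A * B * (J * K)) * X * Y * (S * d) * (T * c))"
    if "N \<noteq> 0" "K \<noteq> 0" "c \<noteq> 0" for d N F A B J X b Y S T K c :: real
    using that by (simp add: divide_simps)
  show ?thesis
    using algebra[OF num_Suc_nonzero num_Suc_nonzero assms(2)] unfolding n
    by (simp only: mass_Suc add_Suc add_Suc_right fct_Suc[of v1] fct_Suc[of j] sft_Suc[of \<beta>2 "Suc j"]
        sft_Suc[of \<beta>1 "Suc (j + v2)"] power_Suc[of \<beta>1 v1])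
qed

end

lemma (in small_deformed_numbers) mass_iterated_sums:
  assumes "0 \<le> \<beta>1" "\<beta>1 < 1"
    and "(\<lambda>v2. sft \<beta>2 (Suc j) * (binom j v2 * \<beta>2 ^ v2) * neg_binomial_mass (j + v2) \<beta>1) sums s"
  shows "iterated_sums (mass (Suc j) \<beta>1 \<beta>2) s"
  unfolding iterated_sums_def mass_factorised
  using assms(3) neg_binomial_mass_sums[OF assms(1,2)]
  by (intro exI[of _ "\<lambda>v2. sft \<beta>2 (Suc j) * (binom j v2 * \<beta>2 ^ v2) * neg_binomial_mass (j + v2) \<beta>1"] conjI allI
      sums_mult) auto

text \<open>
  With \<open>\<phi>\<^sub>1 = 1\<close> both univariate factors are probability distributions, so summing over \<open>v1\<close> and
  then over \<open>v2\<close> contributes a factor \<open>1\<close> each time.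
\<close>

lemma (in small_deformed_numbers) mass_iterated_sums_1:
  assumes "0 \<le> \<beta>1" "\<beta>1 < 1" "0 \<le> \<beta>2" "\<beta>2 < 1" and "\<phi>1 = 1" and "0 < n"
  shows "iterated_sums (mass n \<beta>1 \<beta>2) 1"
proof -
  obtain j where n: "n = Suc j" using assms(6) by (cases n) auto
  show ?thesis
    unfolding n using neg_binomial_mass_sums[OF assms(3,4), of j]
    by (intro mass_iterated_sums assms(1,2))
      (simp only: neg_binomial_mass_eq_1[OF _ _ assms(5)] assms(1-4) mult_1_right)
qed

text \<open>
  The slice \<open>v2 = 1\<close> has a strict deficit even for \<open>n = 1\<close>; the slice \<open>v2 = 0\<close> need not, as the
  negative binomial masses with one success always add up to \<open>1\<close>.
\<close>

lemma (in small_deformed_numbers) mass_iterated_sums_less_1: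
  assumes "0 \<le> \<beta>1" "\<beta>1 < 1" "0 < \<beta>2" "\<beta>2 < 1" and "\<phi>1 < 1" and "0 < n"
  shows "\<exists>s<1. iterated_sums (mass n \<beta>1 \<beta>2) s"
proof -
  obtain j where n: "n = Suc j" using assms(6) by (cases n) auto
  define c where "c = (\<lambda>v2. sft \<beta>2 (Suc j) * (binom j v2 * \<beta>2 ^ v2))"
  have c: "c sums neg_binomial_mass j \<beta>2"
    unfolding c_def using assms by (intro neg_binomial_mass_sums) auto
  have c_pos: "0 < c k" for k
    unfolding c_def using assms sft_pos(1)[of \<beta>2 "Suc j"] binom_pos by simp
  have t: "0 \<le> neg_binomial_mass i \<beta>1" for i
    unfolding neg_binomial_mass_def using assms sft_pos(1)[of \<beta>1 "Suc i"] binom_series_pos[of \<beta>1 i]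
    by (intro mult_nonneg_nonneg) auto
  have le: "c k * neg_binomial_mass (j + k) \<beta>1 \<le> c k" for k
    using neg_binomial_mass_le_1[OF assms(1,2), of "j + k"] c_pos[of k] by (simp add: mult_left_le)
  have less: "c 1 * neg_binomial_mass (j + 1) \<beta>1 < c 1"
    using neg_binomial_mass_less_1[OF assms(1,2,5), of j] c_pos[of 1] by simp
  have sm: "summable (\<lambda>k. c k * neg_binomial_mass (j + k) \<beta>1)"
  proof (rule summable_comparison_test'[OF sums_summable[OF c], of 0])
    show "norm (c k * neg_binomial_mass (j + k) \<beta>1) \<le> c k" for k
      using le[of k] mult_nonneg_nonneg[OF less_imp_le[OF c_pos[of k]] t[of "j + k"]] by simp
  qed
  have "0 < (\<Sum>k. c k - c k * neg_binomial_mass (j + k) \<beta>1)"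
    using le less sums_summable[OF c] sm
    by (intro suminf_pos2[of _ 1] summable_diff) auto
  then have "(\<Sum>k. c k * neg_binomial_mass (j + k) \<beta>1) < suminf c"
    using suminf_diff[OF sums_summable[OF c] sm] by simp
  also have "suminf c \<le> 1"
    using c neg_binomial_mass_le_1[of \<beta>2 j] assms by (simp add: sums_iff)
  finally show ?thesis
    unfolding n using sm assms
    by (intro exI[of _ "\<Sum>k. c k * neg_binomial_mass (j + k) \<beta>1"] conjI mass_iterated_sums)
       (auto simp: c_def summable_sums)
qed

context deformed_numbers
begin

section \<open>Constraints on the structure functions\<close>

text \<open>
  Passing from \<open>v2\<close> to \<open>v2 + 1\<close> appends one factor to the shifted factorial in \<open>\<beta>1\<close>, so positive
  masses force \<open>\<phi>\<^sub>1\<^sup>m - \<beta>\<^sub>1 \<phi>\<^sub>2\<^sup>m > 0\<close> for all \<open>m \<ge> n\<close>. Since \<open>[2] = \<phi>\<^sub>1 + \<phi>\<^sub>2\<close> is positive, the only way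
  to violate the conclusion is \<open>\<bar>\<phi>\<^sub>1\<bar> < \<phi>\<^sub>2\<close>, and then those factors are eventually negative.
\<close>

lemma mass_pos_imp_dominant:
  assumes mass: "\<And>v2. 0 < mass n \<beta>1 \<beta>2 0 v2" and "0 < n" and "0 < \<beta>1" and "0 < \<beta>2"
  shows "\<bar>\<phi>2\<bar> < \<phi>1"
proof -
  obtain j where n: "n = Suc j" using \<open>0 < n\<close> by (cases n) auto
  have sign: "0 < sft \<beta>2 (Suc j) * sft \<beta>1 (Suc (j + v2))" for v2
  proof -
    have "mass n \<beta>1 \<beta>2 0 v2 = (sft \<beta>2 (Suc j) * sft \<beta>1 (Suc (j + v2))) * (binom j v2 * \<beta>2 ^ v2)"
      unfolding n mass_factorised by (simp del: sft_Suc)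
    moreover have "0 < binom j v2 * \<beta>2 ^ v2" using binom_pos \<open>0 < \<beta>2\<close> by simp
    ultimately show ?thesis
      using mass[of v2] zero_less_mult_pos2 by metis
  qed
  have factor: "\<beta>1 * \<phi>2 ^ (n + i) < \<phi>1 ^ (n + i)" for i
  proof -
    have "0 < (sft \<beta>2 (Suc j) * sft \<beta>1 (Suc (j + i))) * (\<phi>1 ^ (n + i) - \<beta>1 * \<phi>2 ^ (n + i))"
      using sign[of "Suc i"] unfolding n sft_Suc[of _ "Suc (j + i)"] add_Suc_right add_Suc
      by (simp only: mult.assoc)
    from zero_less_mult_pos[OF this sign[of i]] show ?thesis by simp
  qed
  have "num 2 = \<phi>1 + \<phi>2"
    using distinct by (simp add: num_eq power2_eq_square field_simps)
  then have two: "0 < \<phi>1 + \<phi>2" using num_pos[of 2] by simp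
  show ?thesis
  proof (rule ccontr)
    assume "\<not> \<bar>\<phi>2\<bar> < \<phi>1"
    with two distinct have lt: "\<bar>\<phi>1\<bar> < \<phi>2" by linarith
    define Q where "Q = \<bar>\<phi>1\<bar> / \<phi>2"
    have Q: "0 \<le> Q" "Q < 1" using lt by (auto simp: Q_def)
    obtain i where i: "Q ^ i < \<beta>1" using real_arch_pow_inv[OF \<open>0 < \<beta>1\<close> Q(2)] by blast
    have "Q ^ (n + i) \<le> Q ^ i" using Q by (intro power_decreasing) auto
    with i have "Q ^ (n + i) * \<phi>2 ^ (n + i) < \<beta>1 * \<phi>2 ^ (n + i)"
      using lt by (intro mult_strict_right_mono) auto
    moreover have "Q ^ (n + i) * \<phi>2 ^ (n + i) = \<bar>\<phi>1\<bar> ^ (n + i)"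
      using lt by (simp add: Q_def power_divide)
    moreover have "\<phi>1 ^ (n + i) \<le> \<bar>\<phi>1\<bar> ^ (n + i)"
      by (simp add: power_abs[symmetric])
    ultimately show False using factor[of i] by linarith
  qed
qed

text \<open>
  The slice at \<open>v2\<close> is a multiple of the binomial series of index \<open>n + v2 - 1\<close> at \<open>\<beta>1\<close>. Its
  convergence bounds \<open>\<phi>\<^sub>1\<close> to arbitrarily high powers by \<open>1 / \<beta>\<^sub>1\<close>.
\<close>

lemma summable_slices_imp_small:
  assumes "\<And>v2. summable (\<lambda>v1. mass n \<beta>1 \<beta>2 v1 v2)" "\<And>v2. mass n \<beta>1 \<beta>2 0 v2 \<noteq> 0"
    and "0 < n" and "0 < \<beta>1"
  shows "\<phi>1 \<le> 1"
proof (rule ccontr)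
  assume "\<not> \<phi>1 \<le> 1"
  then have big: "1 < \<phi>1" by simp
  obtain j where n: "n = Suc j" using \<open>0 < n\<close> by (cases n) auto
  have bound: "\<phi>1 ^ (j + v2) * \<beta>1 < 1" for v2
  proof -
    have eq: "mass n \<beta>1 \<beta>2 v1 v2 = mass n \<beta>1 \<beta>2 0 v2 * (binom (j + v2) v1 * \<beta>1 ^ v1)" for v1
      unfolding n mass_factorised by (simp del: sft_Suc)
    have "summable (\<lambda>v1. binom (j + v2) v1 * \<beta>1 ^ v1)"
      using assms(1)[of v2] assms(2)[of v2] by (subst (asm) eq) simp
    then show ?thesis
      using big \<open>0 < \<beta>1\<close> by (intro binom_series_convergent_imp) auto
  qed
  obtain i where i: "1 / \<beta>1 < \<phi>1 ^ i" using real_arch_pow[OF big] by blast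
  have "\<phi>1 ^ i \<le> \<phi>1 ^ (j + i)" using big by (intro power_increasing) auto
  with i have "1 / \<beta>1 < \<phi>1 ^ (j + i)" by linarith
  then show False using bound[of i] \<open>0 < \<beta>1\<close> by (simp add: field_simps)
qed

end

section \<open>The covariance\<close>

theorem corollary2p17:
  fixes R :: "complex \<times> complex \<Rightarrow> complex" and r :: "int \<Rightarrow> int \<Rightarrow> complex" and l :: nat
    and p q \<phi>1 \<phi>2 \<beta>1 \<beta>2 :: real and n :: nat
    and M :: "'a measure" and V1 V2 :: "'a \<Rightarrow> nat"
  assumes "0 < q" and "q < p" and "p < 1"
    and "meromorphic2 R" and "has_laurent_expansion2 R r l"
    and "\<And>k. 0 < k \<Longrightarrow> R (complex_of_real (p ^ k), complex_of_real (q ^ k)) \<in> \<real>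
                    \<and> 0 < Re (R (complex_of_real (p ^ k), complex_of_real (q ^ k)))"
    and "R (1, 1) = 0"
    and "\<phi>1 \<noteq> \<phi>2"
    and "\<And>k. deformed_num R p q k = (\<phi>1 ^ k - \<phi>2 ^ k) / (\<phi>1 - \<phi>2)"
    and "0 < n" and "0 < \<beta>1" and "\<beta>1 < 1" and "0 < \<beta>2" and "\<beta>2 < 1"
    and "prob_space M"
    and "V1 \<in> measurable M (count_space UNIV)" and "V2 \<in> measurable M (count_space UNIV)"
    and law: "\<And>v1 v2. measure M {x \<in> space M. V1 x = v1 \<and> V2 x = v2} =
                neg_trinomial2_mass R p q \<phi>1 \<phi>2 n \<beta>1 \<beta>2 v1 v2"
    and support: "\<And>v1 v2. 0 < neg_trinomial2_mass R p q \<phi>1 \<phi>2 n \<beta>1 \<beta>2 v1 v2"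
  defines "V_hat \<equiv> (\<lambda>x. (\<phi>1 ^ (n + V2 x) - \<beta>1 * \<phi>2 ^ (n + V2 x)) * deformed_num R p q (V1 x))"
    and "V_bar \<equiv> (\<lambda>x. deformed_num R p q (V2 x))"
  shows "integrable M V_hat \<and> integrable M V_bar \<and> integrable M (\<lambda>x. V_hat x * V_bar x) \<and>
    covariance M V_hat V_bar =
      deformed_num R p q n * \<beta>1 * \<beta>2 / (\<phi>1 ^ n - \<beta>2 * \<phi>2 ^ n) *
      (deformed_num R p q (n + 1) / (\<phi>1 ^ (n + 1) - \<beta>2 * \<phi>2 ^ (n + 1)) -
       deformed_num R p q n / (\<phi>1 ^ n - \<beta>2 * \<phi>2 ^ n))"
proof -
  interpret prob_space M by fact
  interpret deformed_numbers R p q \<phi>1 \<phi>2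
    using assms(6,8,9) by unfold_locales (auto simp: deformed_num_def)
  note V = \<open>V1 \<in> measurable M (count_space UNIV)\<close> \<open>V2 \<in> measurable M (count_space UNIV)\<close>
  note fin = finite_measure_axioms
  have dominant: "\<bar>\<phi>2\<bar> < \<phi>1"
    using support \<open>0 < n\<close> \<open>0 < \<beta>1\<close> \<open>0 < \<beta>2\<close> by (rule mass_pos_imp_dominant)
  have small: "\<phi>1 \<le> 1"
    using summable_slice_measure[OF fin V] support \<open>0 < n\<close> \<open>0 < \<beta>1\<close>
    unfolding law by (intro summable_slices_imp_small[of n \<beta>1 \<beta>2]) (auto simp: less_imp_neq[THEN not_sym])
  interpret small_deformed_numbers R p q \<phi>1 \<phi>2
    using dominant small by unfold_locales
  \<comment> \<open>Otherwise the constant function \<open>1\<close> would integrate to less than \<open>1\<close>.\<close>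
  have one: "\<phi>1 = 1"
  proof (rule ccontr)
    assume "\<phi>1 \<noteq> 1"
    then obtain s where s: "s < 1" "iterated_sums (mass n \<beta>1 \<beta>2) s"
      using mass_iterated_sums_less_1[of \<beta>1 \<beta>2 n] assms(10-14) small by auto
    have "has_bochner_integral M (\<lambda>x. 1::real) s"
      using s(2) by (intro has_bochner_integral_two_nat_valued[OF fin V, of "\<lambda>_ _. 1"]) (auto simp: law)
    moreover have "has_bochner_integral M (\<lambda>x. 1::real) 1"
      by (simp add: has_bochner_integral_iff prob_space)
    ultimately show False
      using s(1) has_bochner_integral_eq by fastforce
  qed
  have norm: "iterated_sums (mass m \<beta>1 \<beta>2) 1" if "0 < m" for m
    using that assms(11-14) one by (intro mass_iterated_sums_1) auto
  have norm_mult: "iterated_sums (\<lambda>v1 v2. k * mass (Suc m) \<beta>1 \<beta>2 v1 v2) k" for k m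
    using iterated_sums_mult[OF norm[of "Suc m"], of k] by simp
  define c where "c m = \<phi>1 ^ m - \<beta>2 * \<phi>2 ^ m" for m
  define d where "d m = \<phi>1 ^ m - \<beta>1 * \<phi>2 ^ m" for m
  have c: "0 < c m" and d: "0 < d m" for m
    unfolding c_def d_def using sft_pos(2) assms(11-14) by auto
  have nonzero: "\<phi>1 ^ m - \<beta>2 * \<phi>2 ^ m \<noteq> 0" for m
    using c[of m] unfolding c_def by linarith
  have snd: "num (Suc v2) * mass m \<beta>1 \<beta>2 v1 (Suc v2) = num m * \<beta>2 / c m * mass (Suc m) \<beta>1 \<beta>2 v1 v2"
    if "0 < m" for m v1 v2
    unfolding c_def by (rule mass_shift_snd[OF that nonzero])
  have fst: "d (m + v2) * num (Suc v1) * mass m \<beta>1 \<beta>2 (Suc v1) v2 =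
      num m * \<beta>1 / c m * mass (Suc m) \<beta>1 \<beta>2 v1 v2" if "0 < m" for m v1 v2
    unfolding c_def d_def by (rule mass_shift_fst[OF that nonzero])
  have hat_sums: "iterated_sums (\<lambda>v1 v2. d (m + v2) * num v1 * mass m \<beta>1 \<beta>2 v1 v2) (num m * \<beta>1 / c m)"
    if "0 < m" for m
  proof (rule iterated_sums_shift_fst)
    show "iterated_sums (\<lambda>v1 v2. d (m + v2) * num (Suc v1) * mass m \<beta>1 \<beta>2 (Suc v1) v2)
        (num m * \<beta>1 / c m)"
      unfolding fst[OF that] by (rule norm_mult)
  qed simp
  have hat: "has_bochner_integral M V_hat (num n * \<beta>1 / c n)"
    unfolding V_hat_def d_def[symmetric] using d hat_sums[OF \<open>0 < n\<close>]
    by (intro has_bochner_integral_two_nat_valued[OF fin V, of "\<lambda>v1 v2. d (n + v2) * num v1"])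
       (auto simp: law less_imp_le)
  have bar: "has_bochner_integral M V_bar (num n * \<beta>2 / c n)"
    unfolding V_bar_def
  proof (intro has_bochner_integral_two_nat_valued[OF fin V, of "\<lambda>v1 v2. num v2"])
    show "iterated_sums (\<lambda>v1 v2. num v2 * measure M {x \<in> space M. V1 x = v1 \<and> V2 x = v2})
        (num n * \<beta>2 / c n)"
      unfolding law
    proof (rule iterated_sums_shift_snd)
      show "iterated_sums (\<lambda>v1 v2. num (Suc v2) * mass n \<beta>1 \<beta>2 v1 (Suc v2)) (num n * \<beta>2 / c n)"
        unfolding snd[OF \<open>0 < n\<close>] by (rule norm_mult)
    qed simp
  qed simp
  have both: "has_bochner_integral M (\<lambda>x. V_hat x * V_bar x)
      (num n * \<beta>2 / c n * (num (Suc n) * \<beta>1 / c (Suc n)))"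
    unfolding V_bar_def V_hat_def d_def[symmetric]
  proof (intro has_bochner_integral_two_nat_valued[OF fin V, of "\<lambda>v1 v2. d (n + v2) * num v1 * num v2"])
    \<comment> \<open>Shifting \<open>v2\<close> first turns the factor \<open>d (n + v2 + 1)\<close> into the one belonging to parameter \<open>n + 1\<close>,
      so that the shift in \<open>v1\<close> can then be applied at that parameter.\<close>
    have step: "d (n + Suc v2) * num v1 * num (Suc v2) * mass n \<beta>1 \<beta>2 v1 (Suc v2) =
        num n * \<beta>2 / c n * (d (Suc n + v2) * num v1 * mass (Suc n) \<beta>1 \<beta>2 v1 v2)" for v1 v2
    proof -
      have "d (n + Suc v2) * num v1 * num (Suc v2) * mass n \<beta>1 \<beta>2 v1 (Suc v2) =
          d (Suc n + v2) * num v1 * (num (Suc v2) * mass n \<beta>1 \<beta>2 v1 (Suc v2))"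
        by (simp only: mult.assoc add_Suc_right add_Suc)
      then show ?thesis
        unfolding snd[OF \<open>0 < n\<close>] by (simp only: mult_ac)
    qed
    show "iterated_sums (\<lambda>v1 v2. d (n + v2) * num v1 * num v2 *
        measure M {x \<in> space M. V1 x = v1 \<and> V2 x = v2})
        (num n * \<beta>2 / c n * (num (Suc n) * \<beta>1 / c (Suc n)))"
      unfolding law
    proof (rule iterated_sums_shift_snd)
      show "iterated_sums
          (\<lambda>v1 v2. d (n + Suc v2) * num v1 * num (Suc v2) * mass n \<beta>1 \<beta>2 v1 (Suc v2))
          (num n * \<beta>2 / c n * (num (Suc n) * \<beta>1 / c (Suc n)))"
        unfolding step by (intro iterated_sums_mult hat_sums) simp
    qed simp
  qed (use d in \<open>simp add: less_imp_le\<close>)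
  have "covariance M V_hat V_bar = num n * \<beta>2 / c n * (num (Suc n) * \<beta>1 / c (Suc n)) -
      num n * \<beta>1 / c n * (num n * \<beta>2 / c n)"
    using hat bar both by (simp add: covariance_def has_bochner_integral_iff)
  also have "\<dots> = num n * \<beta>1 * \<beta>2 / c n * (num (n + 1) / c (n + 1) - num n / c n)"
    by (simp add: algebra_simps)
  finally show ?thesis
    using hat bar both by (simp only: c_def has_bochner_integral_iff simp_thms)
qed

end
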